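(* Let $\{A_\lambda:\lambda\in\Lambda\}$ be a family of pseudocompact topological $MV$-algebras whose underlying spaces are Tychonoff. Then the product $A=\prod_{\lambda\in\Lambda}A_\lambda$, with the product topology and pointwise $MV$-operations, is a pseudocompact topological $MV$-algebra.
   Context: An $MV$-algebra is an algebra $(A,\oplus,{}^*,0)$ of type $(2,1,0)$ such that $(A,\oplus,0)$ is a commutative monoid, $x^{**}=x$, $x\oplus 0^*=0^*$ and $(x^*\oplus y)^*\oplus y=(y^*\oplus x)^*\oplus x$ for all $x,y$. A topological $MV$-algebra is an $MV$-algebra $A$ equipped with a topology such that $\oplus:A\times A\to A$ and ${}^*:A\to A$ are continuous. A Tychonoff space is pseudocompact if every continuous real-valued function on it is bounded. *)

theory Defs
  imports "HOL-Analysis.Analysis" "HOL-Algebra.Group"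
begin

record 'a mv_algebra = "'a partial_object" +
  mv_plus :: "'a \<Rightarrow> 'a \<Rightarrow> 'a" (infixl "\<oplus>\<index>" 65)
  mv_neg :: "'a \<Rightarrow> 'a" ("\<sim>\<index> _" [81] 80)
  mv_zero :: 'a ("\<zero>\<index>")

locale mv_algebra =
  fixes A (structure)
  assumes comm_monoid: "comm_monoid \<lparr>carrier = carrier A, mult = mv_plus A, one = mv_zero A\<rparr>"
    and neg_closed: "x \<in> carrier A \<Longrightarrow> \<sim> x \<in> carrier A"
    and neg_neg: "x \<in> carrier A \<Longrightarrow> \<sim> (\<sim> x) = x"
    and plus_neg_zero: "x \<in> carrier A \<Longrightarrow> x \<oplus> \<sim> \<zero> = \<sim> \<zero>"
    and lukasiewicz: "\<lbrakk>x \<in> carrier A; y \<in> carrier A\<rbrakk>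
      \<Longrightarrow> \<sim> (\<sim> x \<oplus> y) \<oplus> y = \<sim> (\<sim> y \<oplus> x) \<oplus> x"

locale topological_mv_algebra = mv_algebra A for A (structure) +
  fixes T :: "'a topology"
  assumes topspace_eq: "topspace T = carrier A"
    and continuous_plus: "continuous_map (prod_topology T T) T (\<lambda>(x, y). x \<oplus> y)"
    and continuous_neg: "continuous_map T T (\<lambda>x. \<sim> x)"

definition product_mv_algebra ::
    "'i set \<Rightarrow> ('i \<Rightarrow> ('a, 'm) mv_algebra_scheme) \<Rightarrow> ('i \<Rightarrow> 'a) mv_algebra" where
  "product_mv_algebra I A =
    \<lparr>carrier = (\<Pi>\<^sub>E i\<in>I. carrier (A i)),
     mv_plus = (\<lambda>x y. \<lambda>i\<in>I. x i \<oplus>\<^bsub>A i\<^esub> y i),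
     mv_neg = (\<lambda>x. \<lambda>i\<in>I. \<sim>\<^bsub>A i\<^esub> x i),
     mv_zero = (\<lambda>i\<in>I. \<zero>\<^bsub>A i\<^esub>)\<rparr>"

definition tychonoff_space :: "'a topology \<Rightarrow> bool" where
  "tychonoff_space X \<longleftrightarrow> completely_regular_space X \<and> Hausdorff_space X"

text \<open>Following the usual convention, pseudocompactness is a property of Tychonoff spaces, so
  separation is part of the definition.\<close>

definition pseudocompact_space :: "'a topology \<Rightarrow> bool" where
  "pseudocompact_space X \<longleftrightarrow> tychonoff_space X \<and>
    (\<forall>f. continuous_map X euclideanreal f \<longrightarrow> bounded (f ` topspace X))"

end

theory Submission
  imports Defs "HOL-Library.Diagonal_Subsequence"
begin

text \<open>
  The term \<open>m x y z = ((x \<ominus> y) \<oplus> z) \<and> ((z \<ominus> y) \<oplus> x)\<close> is a continuous Mal'cev operation on a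
  topological MV-algebra: \<open>m x y y = x = m y y x\<close>. In a regular pseudocompact space with such an
  operation every sequence of nonempty open sets has a subsequence converging to a point \<open>x\<close>, in
  the sense that each neighbourhood of \<open>x\<close> meets almost all of its members. Indeed, start with a
  cluster point \<open>x\<close> and choose shrinking neighbourhoods \<open>V k\<close> of \<open>x\<close> and open sets \<open>B k \<subseteq> V (k - 1)\<close>
  with \<open>m (B k) (V k) x \<subseteq> U (r k)\<close>. If a neighbourhood \<open>P\<close> of \<open>x\<close> missed infinitely many \<open>U (r k)\<close>,
  then the corresponding \<open>B k\<close> would have a cluster point \<open>x'\<close>, which lies in every \<open>V k\<close>. As
  \<open>m x' x' x = x \<in> P\<close>, some \<open>y \<in> B k\<close> close to \<open>x'\<close> has \<open>m y x' x \<in> P \<inter> U (r k)\<close>, a contradiction.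
  Unlike pseudocompactness, this sequential property passes to arbitrary products, because
  countably many boxes involve only countably many coordinates and a diagonal argument applies.
\<close>

section \<open>Cluster points of sequences of open sets\<close>

text \<open>Cluster-point form of the statement that every locally finite sequence of nonempty open
  sets is finite. Indices are counted rather than sets, so a sequence may repeat a set. No
  separation axiom is built in.\<close>

definition feebly_compact_space :: "'a topology \<Rightarrow> bool" where
  "feebly_compact_space X \<longleftrightarrow>
    (\<forall>U. (\<forall>n::nat. openin X (U n) \<and> U n \<noteq> {}) \<longrightarrow>
      (\<exists>x\<in>topspace X. \<forall>P. openin X P \<and> x \<in> P \<longrightarrow> infinite {n. U n \<inter> P \<noteq> {}}))"

text \<open>A weak notion of convergence: a neighbourhood of the limit has to meet almost all of the
  sets, not contain them. This weakness is what open sets in a product can satisfy coordinate by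
  coordinate.\<close>

definition sets_converge :: "'a topology \<Rightarrow> (nat \<Rightarrow> 'a set) \<Rightarrow> 'a \<Rightarrow> bool" where
  "sets_converge X U x \<longleftrightarrow> x \<in> topspace X \<and>
    (\<forall>P. openin X P \<and> x \<in> P \<longrightarrow> (\<forall>\<^sub>F n in sequentially. U n \<inter> P \<noteq> {}))"

definition sequentially_feebly_compact_space :: "'a topology \<Rightarrow> bool" where
  "sequentially_feebly_compact_space X \<longleftrightarrow>
    (\<forall>U. (\<forall>n. openin X (U n) \<and> U n \<noteq> {}) \<longrightarrow>
      (\<exists>(r :: nat \<Rightarrow> nat) x. strict_mono r \<and> sets_converge X (U \<circ> r) x))"

lemma sets_converge_subseq:
  assumes "sets_converge X U x" "strict_mono r"
  shows "sets_converge X (U \<circ> r) x"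
  unfolding sets_converge_def o_def
proof (intro conjI allI impI)
  show "x \<in> topspace X" using assms(1) by (simp add: sets_converge_def)
  fix P
  assume "openin X P \<and> x \<in> P"
  then have "\<forall>\<^sub>F n in sequentially. U n \<inter> P \<noteq> {}"
    using assms(1) by (simp add: sets_converge_def)
  then show "\<forall>\<^sub>F n in sequentially. U (r n) \<inter> P \<noteq> {}"
    by (rule eventually_subseq[OF assms(2)])
qed

lemma feebly_compact_spaceE:
  fixes U :: "nat \<Rightarrow> 'a set"
  assumes "feebly_compact_space X" "\<And>n. openin X (U n)" "\<And>n. U n \<noteq> {}"
  obtains x where "x \<in> topspace X"
    "\<And>P. openin X P \<Longrightarrow> x \<in> P \<Longrightarrow> infinite {n. U n \<inter> P \<noteq> {}}"
proof -
  have "\<exists>x\<in>topspace X. \<forall>P. openin X P \<and> x \<in> P \<longrightarrow> infinite {n. U n \<inter> P \<noteq> {}}"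
    using assms(1)[unfolded feebly_compact_space_def, rule_format, of U] assms(2,3) by simp
  with that show ?thesis by auto
qed

lemma sequentially_feebly_compact_imp_feebly_compact:
  assumes "sequentially_feebly_compact_space X"
  shows "feebly_compact_space X"
  unfolding feebly_compact_space_def
proof (intro allI impI)
  fix U :: "nat \<Rightarrow> 'a set"
  assume "\<forall>n. openin X (U n) \<and> U n \<noteq> {}"
  then obtain r :: "nat \<Rightarrow> nat" and x where r: "strict_mono r" and x: "sets_converge X (U \<circ> r) x"
    using assms unfolding sequentially_feebly_compact_space_def by blast
  have "infinite {n. U n \<inter> P \<noteq> {}}" if "openin X P" "x \<in> P" for P
  proof -
    have "\<forall>\<^sub>F n in sequentially. U (r n) \<inter> P \<noteq> {}"
      using x that unfolding sets_converge_def by simp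
    then obtain N where "\<And>n. n \<ge> N \<Longrightarrow> U (r n) \<inter> P \<noteq> {}"
      unfolding eventually_sequentially by blast
    then have "r ` {N..} \<subseteq> {n. U n \<inter> P \<noteq> {}}" by auto
    moreover have "infinite (r ` {N..})"
      using r by (simp add: finite_image_iff strict_mono_imp_inj_on infinite_Ici)
    ultimately show ?thesis using finite_subset by blast
  qed
  then show "\<exists>x\<in>topspace X. \<forall>P. openin X P \<and> x \<in> P \<longrightarrow> infinite {n. U n \<inter> P \<noteq> {}}"
    using x unfolding sets_converge_def by blast
qed

text \<open>If \<open>f\<close> is unbounded, the open sets where its modulus exceeds
  \<open>n\<close> are all nonempty. They have no cluster point \<open>x\<close>, because near
  \<open>x\<close> the modulus stays below \<open>\<bar>f x\<bar> + 1\<close>.\<close>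

lemma feebly_compact_imp_bounded:
  assumes X: "feebly_compact_space X" and f: "continuous_map X euclideanreal f"
  shows "bounded (f ` topspace X)"
proof (rule ccontr)
  assume unb: "\<not> bounded (f ` topspace X)"
  define U where "U n = {x \<in> topspace X. f x \<in> {y. \<bar>y\<bar> > real n}}" for n
  have "openin X (U n)" for n
    unfolding U_def
    by (rule openin_continuous_map_preimage[OF f]) (auto intro!: open_Collect_less continuous_intros)
  moreover have "U n \<noteq> {}" for n
    using unb unfolding U_def bounded_iff by (force simp: not_le)
  ultimately obtain x where x: "x \<in> topspace X"
    and inf: "\<And>P. openin X P \<Longrightarrow> x \<in> P \<Longrightarrow> infinite {n. U n \<inter> P \<noteq> {}}"
    using feebly_compact_spaceE[OF X, of U] by metis
  define P where "P = {y \<in> topspace X. f y \<in> {z. \<bar>z\<bar> < \<bar>f x\<bar> + 1}}"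
  have "openin X P"
    unfolding P_def
    by (rule openin_continuous_map_preimage[OF f]) (auto intro!: open_Collect_less continuous_intros)
  then have "infinite {n. U n \<inter> P \<noteq> {}}"
    using inf x by (simp add: P_def)
  moreover have "{n. U n \<inter> P \<noteq> {}} \<subseteq> {..nat \<lceil>\<bar>f x\<bar> + 1\<rceil>}"
  proof
    fix n
    assume "n \<in> {n. U n \<inter> P \<noteq> {}}"
    then have "real n < \<bar>f x\<bar> + 1" by (auto simp: U_def P_def)
    then have "n \<le> nat \<lceil>\<bar>f x\<bar> + 1\<rceil>" by linarith
    then show "n \<in> {..nat \<lceil>\<bar>f x\<bar> + 1\<rceil>}" by simp
  qed
  ultimately show False using finite_subset by blast
qed

text \<open>For a locally finite sequence of open sets, the sum of bumps of height \<open>n\<close> supported in the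
  \<open>n\<close>-th set would be continuous and unbounded.\<close>

lemma pseudocompact_imp_feebly_compact:
  assumes X: "pseudocompact_space X"
  shows "feebly_compact_space X"
  unfolding feebly_compact_space_def
proof (intro allI impI, rule ccontr)
  fix U :: "nat \<Rightarrow> 'a set"
  assume U: "\<forall>n. openin X (U n) \<and> U n \<noteq> {}"
    and "\<not> (\<exists>x\<in>topspace X. \<forall>P. openin X P \<and> x \<in> P \<longrightarrow> infinite {n. U n \<inter> P \<noteq> {}})"
  then have "\<forall>x\<in>topspace X. \<exists>P. openin X P \<and> x \<in> P \<and> finite {n. U n \<inter> P \<noteq> {}}"
    by blast
  then obtain P where P: "\<And>x. x \<in> topspace X \<Longrightarrow>
      openin X (P x) \<and> x \<in> P x \<and> finite {n. U n \<inter> P x \<noteq> {}}"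
    by metis
  have cr: "completely_regular_space X"
    using X by (simp add: pseudocompact_space_def tychonoff_space_def)
  have "\<exists>f w. w \<in> U n \<and> continuous_map X (top_of_set {0..1::real}) f \<and> f w = 0 \<and>
      f ` (topspace X - U n) \<subseteq> {1}" for n
  proof -
    obtain w where w: "w \<in> U n" using U by blast
    moreover have "closedin X (topspace X - U n)" "w \<in> topspace X - (topspace X - U n)"
      using U w openin_subset by blast+
    ultimately show ?thesis
      using cr unfolding completely_regular_space_def by blast
  qed
  then obtain f w where w: "\<And>n. w n \<in> U n"
    and f: "\<And>n. continuous_map X (top_of_set {0..1::real}) (f n)"
    and fw: "\<And>n. f n (w n) = 0" and f1: "\<And>n. f n ` (topspace X - U n) \<subseteq> {1}"
    by metis
  have fc: "continuous_map X euclideanreal (f n)" and f_le: "x \<in> topspace X \<Longrightarrow> f n x \<le> 1" for n x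
    using f[of n] by (auto simp: continuous_map_in_subtopology)
  \<comment> \<open>The bump \<open>1 - f n\<close> is 1 at \<open>w n\<close> and 0 off
    \<open>U n\<close>, so \<open>g n\<close> reaches the height \<open>n\<close> inside
    \<open>U n\<close>.\<close>
  define g where "g n x = real n * (1 - f n x)" for n x
  \<comment> \<open>At each point of the space the index set is finite, so the default value 0 of
    infinite sums never intervenes. On \<open>P y\<close> the sum \<open>G\<close> agrees with
    \<open>S y\<close>, whose finite index set no longer depends on the point; continuity of
    \<open>G\<close> follows by pasting.\<close>
  define G where "G x = (\<Sum>n | x \<in> U n. g n x)" for x
  define S where "S y x = (\<Sum>n | U n \<inter> P y \<noteq> {}. g n x)" for y x
  have GS: "G x = S y x" if "y \<in> topspace X" "x \<in> P y" for x y
    unfolding G_def S_def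
  proof (rule sum.mono_neutral_left)
    show "finite {n. U n \<inter> P y \<noteq> {}}" using P that by blast
    show "\<forall>n\<in>{n. U n \<inter> P y \<noteq> {}} - {n. x \<in> U n}. g n x = 0"
    proof
      fix n
      assume "n \<in> {n. U n \<inter> P y \<noteq> {}} - {n. x \<in> U n}"
      moreover have "x \<in> topspace X" using P that openin_subset by blast
      ultimately have "f n x = 1" using f1 by blast
      then show "g n x = 0" by (simp add: g_def)
    qed
  qed (use that in auto)
  have "continuous_map X euclideanreal G"
  proof (rule pasting_lemma[where I = "topspace X" and T = P and f = S])
    fix y
    assume y: "y \<in> topspace X"
    show "openin X (P y)" using P y by blast
    have "continuous_map X euclideanreal (S y)"
      unfolding S_def g_def using P[OF y] fc
      by (intro continuous_map_sum continuous_map_real_mult continuous_map_diff) auto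
    then show "continuous_map (subtopology X (P y)) euclideanreal (S y)"
      by (rule continuous_map_from_subtopology)
  next
    fix i j x
    assume "i \<in> topspace X" "j \<in> topspace X" "x \<in> topspace X \<inter> P i \<inter> P j"
    then show "S i x = S j x" using GS by (metis IntE)
  next
    fix x
    assume "x \<in> topspace X"
    then show "\<exists>j. j \<in> topspace X \<and> x \<in> P j \<and> G x = S j x"
      using GS P by blast
  qed
  then have "bounded (G ` topspace X)"
    using X by (simp add: pseudocompact_space_def)
  then obtain c where c: "\<And>x. x \<in> topspace X \<Longrightarrow> \<bar>G x\<bar> \<le> c"
    unfolding bounded_iff by (metis image_eqI real_norm_def)
  obtain n :: nat where n: "c < real n" using reals_Archimedean2 by blast
  have wn: "w n \<in> topspace X" using U w openin_subset by blast
  have "finite {k. w n \<in> U k}"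
    by (rule finite_subset[of _ "{k. U k \<inter> P (w n) \<noteq> {}}"]) (use P[OF wn] in auto)
  then have "g n (w n) \<le> G (w n)"
    unfolding G_def using w f_le[OF wn] by (intro member_le_sum) (auto simp: g_def)
  then have "real n \<le> G (w n)" by (simp add: g_def fw)
  with c[OF wn] n show False by linarith
qed

section \<open>Mal'cev operations\<close>

definition malcev_operation :: "'a topology \<Rightarrow> ('a \<Rightarrow> 'a \<Rightarrow> 'a \<Rightarrow> 'a) \<Rightarrow> bool" where
  "malcev_operation X m \<longleftrightarrow>
    continuous_map (prod_topology X (prod_topology X X)) X (\<lambda>(x, y, z). m x y z) \<and>
    (\<forall>x\<in>topspace X. \<forall>y\<in>topspace X. m x y y = x \<and> m y y x = x)"

lemma malcev_operation_continuous:
  assumes "malcev_operation X m"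
    and "continuous_map Z X f" "continuous_map Z X g" "continuous_map Z X h"
  shows "continuous_map Z X (\<lambda>t. m (f t) (g t) (h t))"
proof -
  have "continuous_map Z X ((\<lambda>(x, y, z). m x y z) \<circ> (\<lambda>t. (f t, g t, h t)))"
    using assms unfolding malcev_operation_def
    by (intro continuous_map_compose[where X' = "prod_topology X (prod_topology X X)"]
        continuous_map_pairedI) auto
  then show ?thesis by (simp add: o_def)
qed

theorem malcev_imp_sequentially_feebly_compact:
  assumes fc: "feebly_compact_space X" and reg: "regular_space X" and m: "malcev_operation X m"
  shows "sequentially_feebly_compact_space X"
  unfolding sequentially_feebly_compact_space_def
proof (intro allI impI)
  fix U :: "nat \<Rightarrow> 'a set"
  assume U: "\<forall>n. openin X (U n) \<and> U n \<noteq> {}"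
  then obtain x where x: "x \<in> topspace X"
    and inf: "\<And>P. openin X P \<Longrightarrow> x \<in> P \<Longrightarrow> infinite {n. U n \<inter> P \<noteq> {}}"
    using feebly_compact_spaceE[OF fc, of U] by metis
  \<comment> \<open>A triple is one stage of the construction: the chosen index \<open>r k\<close>
    with the sets \<open>B k\<close> and \<open>V k\<close> of the overview.\<close>
  define good where "good = (\<lambda>(n, B, V). openin X B \<and> B \<noteq> {} \<and> openin X V \<and> x \<in> V \<and>
      (\<forall>y\<in>B. \<forall>v\<in>V. m y v x \<in> U n))"
  \<comment> \<open>The closed set \<open>C\<close> between \<open>V'\<close> and \<open>V\<close>
    later forces cluster points of the \<open>B k\<close> into every \<open>V k\<close>.\<close>
  define succ where "succ = (\<lambda>(n :: nat, B :: 'a set, V) (n', B', V').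
      n < n' \<and> B' \<subseteq> V \<and> (\<exists>C. closedin X C \<and> V' \<subseteq> C \<and> C \<subseteq> V))"
  have step: "\<exists>t'. good t' \<and> succ (n, B, V) t'" if V: "openin X V" "x \<in> V" for n B V
  proof -
    obtain n' where n': "n' > n" "U n' \<inter> V \<noteq> {}"
      using inf[OF V] unfolding infinite_nat_iff_unbounded by blast
    then obtain w where w: "w \<in> U n'" "w \<in> V" by blast
    have wX: "w \<in> topspace X" using w V openin_subset by blast
    \<comment> \<open>The identity \<open>m w x x = w\<close> puts \<open>(w, x)\<close> into
      \<open>S\<close>. An open box around that point inside \<open>S\<close> provides
      \<open>B0\<close> and \<open>V0\<close>.\<close>
    define S where "S = {p \<in> topspace (prod_topology X X). m (fst p) (snd p) x \<in> U n'}"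
    have "openin (prod_topology X X) S"
      unfolding S_def using m U x
      by (intro openin_continuous_map_preimage[where Y = X] malcev_operation_continuous[OF m]
          continuous_map_fst continuous_map_snd) auto
    moreover have "(w, x) \<in> S"
      using m w wX x by (auto simp: S_def malcev_operation_def)
    ultimately obtain B0 V0 where BV: "openin X B0" "openin X V0" "w \<in> B0" "x \<in> V0" "B0 \<times> V0 \<subseteq> S"
      by (metis openin_prod_topology_alt)
    have "openin X (V0 \<inter> V)" "x \<in> V0 \<inter> V" using BV V by auto
    then obtain V' C where V': "openin X V'" "closedin X C" "x \<in> V'" "V' \<subseteq> C" "C \<subseteq> V0 \<inter> V"
      using reg unfolding neighbourhood_base_of_closedin[symmetric] neighbourhood_base_of by metis
    have "m y v x \<in> U n'" if "y \<in> B0 \<inter> V" "v \<in> V'" for y v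
    proof -
      have "(y, v) \<in> S" using that BV V' by blast
      then show ?thesis by (simp add: S_def)
    qed
    moreover have "w \<in> B0 \<inter> V" "openin X (B0 \<inter> V)" using BV V w by auto
    ultimately have "good (n', B0 \<inter> V, V')"
      using V' unfolding good_def by blast
    moreover have "succ (n, B, V) (n', B0 \<inter> V, V')"
      using V' n' by (auto simp: succ_def)
    ultimately show ?thesis by blast
  qed
  have "\<exists>t. \<forall>k. good (t k) \<and> succ (t k) (t (Suc k))"
  proof (rule dependent_nat_choice)
    \<comment> \<open>\<open>step\<close> asks nothing of its \<open>n\<close> and \<open>B\<close>,
      so the first stage comes from the whole space in the role of \<open>V\<close>.\<close>
    show "\<exists>t. good t"
      using step[of "topspace X"] x by blast
    show "\<exists>t'. good t' \<and> succ t t'" if "good t" for t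
      using step that by (cases t) (auto simp: good_def)
  qed
  then obtain t where t: "\<And>k. good (t k)" "\<And>k. succ (t k) (t (Suc k))" by blast
  define r where "r k = fst (t k)" for k
  define B where "B k = fst (snd (t k))" for k
  define V where "V k = snd (snd (t k))" for k
  have B: "openin X (B k)" "B k \<noteq> {}" and V: "openin X (V k)" "x \<in> V k"
    and BV: "\<And>y v. y \<in> B k \<Longrightarrow> v \<in> V k \<Longrightarrow> m y v x \<in> U (r k)" for k
    using t(1)[of k] by (auto simp: good_def r_def B_def V_def split: prod.splits)
  have r: "r k < r (Suc k)" and B_sub: "B (Suc k) \<subseteq> V k"
    and V_sub: "\<exists>C. closedin X C \<and> V (Suc k) \<subseteq> C \<and> C \<subseteq> V k" for k
    using t(2)[of k] by (auto simp: succ_def r_def B_def V_def split: prod.splits)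
  have "V (Suc k) \<subseteq> V k" for k using V_sub[of k] by blast
  then have V_mono: "V j \<subseteq> V i" if "i \<le> j" for i j
    using that by (rule lift_Suc_antimono_le)
  have "\<forall>\<^sub>F k in sequentially. U (r k) \<inter> P \<noteq> {}" if P: "openin X P" "x \<in> P" for P
  proof (rule ccontr)
    assume "\<not> ?thesis"
    then have S: "infinite {k. U (r k) \<inter> P = {}}" (is "infinite ?S")
      by (simp add: not_eventually cofinite_eq_sequentially[symmetric] frequently_cofinite)
    \<comment> \<open>\<open>e\<close> lists the stages whose sets miss \<open>P\<close>; feeble
      compactness is applied again, now to the sets \<open>B\<close> along this list.\<close>
    define e where "e = enumerate ?S"
    have e: "strict_mono e" "e i \<in> ?S" for i
      using S by (auto simp: e_def strict_mono_enumerate enumerate_in_set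
          simp del: mem_Collect_eq)
    obtain y where y: "y \<in> topspace X"
      and y_inf: "\<And>Q. openin X Q \<Longrightarrow> y \<in> Q \<Longrightarrow> infinite {i. B (e i) \<inter> Q \<noteq> {}}"
      using feebly_compact_spaceE[OF fc, of "\<lambda>i. B (e i)"] B by metis
    \<comment> \<open>Otherwise the complement of \<open>C\<close> is a neighbourhood of
      \<open>y\<close> and meets some \<open>B (e i)\<close> with \<open>i > Suc k\<close>. But then
      \<open>e i = Suc j\<close> with \<open>j \<ge> Suc k\<close>, and \<open>B (Suc j)\<close>
      lies in \<open>V j\<close>, hence in \<open>V (Suc k)\<close> and in \<open>C\<close>.\<close>
    have yV: "y \<in> V k" for k
    proof (rule ccontr)
      assume "y \<notin> V k"
      obtain C where C: "closedin X C" "V (Suc k) \<subseteq> C" "C \<subseteq> V k" using V_sub by blast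
      have "infinite {i. B (e i) \<inter> (topspace X - C) \<noteq> {}}"
        using y_inf[of "topspace X - C"] C y \<open>y \<notin> V k\<close> by blast
      then obtain i where i: "i > Suc k" "B (e i) \<inter> (topspace X - C) \<noteq> {}"
        unfolding infinite_nat_iff_unbounded by blast
      have "Suc k < e i" using i seq_suble[OF e(1), of i] by linarith
      then obtain j where j: "e i = Suc j" "Suc k \<le> j" by (cases "e i") auto
      have "B (e i) \<subseteq> C" using j B_sub[of j] V_mono[of "Suc k" j] C by auto
      with i show False by blast
    qed
    \<comment> \<open>The other Mal'cev identity, \<open>m y y x = x\<close>, makes \<open>Q\<close>
      a neighbourhood of \<open>y\<close>. A single \<open>z\<close> in \<open>Q\<close> and some
      \<open>B (e i)\<close> suffices, since \<open>y\<close> lies in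
      \<open>V (e i)\<close>.\<close>
    define Q where "Q = {z \<in> topspace X. m z y x \<in> P}"
    have "openin X Q"
      unfolding Q_def using P x y
      by (intro openin_continuous_map_preimage[where Y = X] malcev_operation_continuous[OF m]) auto
    moreover have "y \<in> Q" using m P x y by (auto simp: Q_def malcev_operation_def)
    ultimately have "{i. B (e i) \<inter> Q \<noteq> {}} \<noteq> {}" using y_inf by (metis finite.emptyI)
    then obtain i z where "z \<in> B (e i)" "z \<in> Q" by blast
    then have "m z y x \<in> U (r (e i)) \<inter> P" using BV yV by (auto simp: Q_def)
    with e(2)[of i] show False by blast
  qed
  then have "sets_converge X (U \<circ> r) x"
    using x by (simp add: sets_converge_def)
  moreover have "strict_mono r" using r by (simp add: strict_mono_Suc_iff)
  ultimately show "\<exists>(r :: nat \<Rightarrow> nat) x. strict_mono r \<and> sets_converge X (U \<circ> r) x" by blast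
qed

section \<open>Products\<close>

lemma openin_product_topology_box:
  assumes "openin (product_topology X I) U" "U \<noteq> {}"
  obtains B where "finite {i \<in> I. B i \<noteq> topspace (X i)}"
    "\<And>i. i \<in> I \<Longrightarrow> openin (X i) (B i)" "\<And>i. i \<in> I \<Longrightarrow> B i \<noteq> {}" "Pi\<^sub>E I B \<subseteq> U"
proof -
  obtain u where "u \<in> U" using assms by blast
  then obtain B where "finite {i \<in> I. B i \<noteq> topspace (X i)}"
    "\<forall>i\<in>I. openin (X i) (B i)" "u \<in> Pi\<^sub>E I B" "Pi\<^sub>E I B \<subseteq> U"
    using assms(1) unfolding openin_product_topology_alt by metis
  then show ?thesis using that by blast
qed

theorem sequentially_feebly_compact_product:
  assumes X: "\<And>i. i \<in> I \<Longrightarrow> sequentially_feebly_compact_space (X i)"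
  shows "sequentially_feebly_compact_space (product_topology X I)"
  unfolding sequentially_feebly_compact_space_def
proof (intro allI impI)
  fix U :: "nat \<Rightarrow> ('a \<Rightarrow> 'b) set"
  assume U: "\<forall>n. openin (product_topology X I) (U n) \<and> U n \<noteq> {}"
  have "\<exists>B. finite {i \<in> I. B i \<noteq> topspace (X i)} \<and>
      (\<forall>i\<in>I. openin (X i) (B i) \<and> B i \<noteq> {}) \<and> Pi\<^sub>E I B \<subseteq> U n" for n
  proof -
    have "openin (product_topology X I) (U n)" "U n \<noteq> {}" using U by auto
    then show ?thesis by (rule openin_product_topology_box) blast
  qed
  then have "\<exists>B. \<forall>n. finite {i \<in> I. B n i \<noteq> topspace (X i)} \<and>
      (\<forall>i\<in>I. openin (X i) (B n i) \<and> B n i \<noteq> {}) \<and> Pi\<^sub>E I (B n) \<subseteq> U n"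
    by (intro choice allI)
  then obtain B where fin: "\<And>n. finite {i \<in> I. B n i \<noteq> topspace (X i)}"
    and B: "\<And>n i. i \<in> I \<Longrightarrow> openin (X i) (B n i)" "\<And>n i. i \<in> I \<Longrightarrow> B n i \<noteq> {}"
    and BU: "\<And>n. Pi\<^sub>E I (B n) \<subseteq> U n"
    by blast
  \<comment> \<open>\<open>J\<close> collects the coordinates restricted by at least one box; it is
    a countable union of finite sets.\<close>
  define J where "J = (\<Union>n. {i \<in> I. B n i \<noteq> topspace (X i)})"
  have J: "countable J" unfolding J_def using fin by (simp add: countable_finite)
  \<comment> \<open>The guard covers empty \<open>J\<close>, where \<open>from_nat_into\<close>
    returns an arbitrary value that may lie outside \<open>I\<close>.\<close>
  define conv where "conv n s \<longleftrightarrow> (from_nat_into J n \<in> I \<longrightarrow>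
      (\<exists>x. sets_converge (X (from_nat_into J n)) (\<lambda>k. B (s k) (from_nat_into J n)) x))"
    for n and s :: "nat \<Rightarrow> nat"
  interpret subseqs conv
  proof
    fix n and s :: "nat \<Rightarrow> nat"
    show "\<exists>r. strict_mono r \<and> conv n (s \<circ> r)"
    proof (cases "from_nat_into J n \<in> I")
      case True
      let ?i = "from_nat_into J n"
      have "\<forall>k. openin (X ?i) (B (s k) ?i) \<and> B (s k) ?i \<noteq> {}"
        using B True by blast
      then obtain r :: "nat \<Rightarrow> nat" and x where "strict_mono r"
        "sets_converge (X ?i) ((\<lambda>k. B (s k) ?i) \<circ> r) x"
        using X[OF True] unfolding sequentially_feebly_compact_space_def by meson
      then show ?thesis by (auto simp: conv_def o_def)
    next
      case False
      then show ?thesis using strict_mono_id by (auto simp: conv_def)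
    qed
  qed
  have conv_subseq: "conv n (s \<circ> r)" if "strict_mono r" "conv n s" for r s n
    using that sets_converge_subseq[OF _ that(1)] unfolding conv_def o_def by fast
  have "\<exists>x. sets_converge (X i) (\<lambda>k. B (diagseq k) i) x" if i: "i \<in> I" for i
  proof (cases "i \<in> J")
    case True
    define n where "n = to_nat_on J i"
    have n: "from_nat_into J n = i" using J True by (simp add: n_def)
    \<comment> \<open>From index \<open>Suc n\<close> on, the diagonal sequence is a subsequence of
      one already convergent in coordinate \<open>i\<close>. The shift is harmless because
      convergence concerns only tails.\<close>
    have "conv n (diagseq \<circ> (+) (Suc n))"
      by (rule diagseq_holds) (rule conv_subseq)
    then obtain x where "sets_converge (X i) (\<lambda>k. B (diagseq (k + Suc n)) i) x"
      using i n by (auto simp: conv_def o_def add.commute)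
    then have "sets_converge (X i) (\<lambda>k. B (diagseq k) i) x"
      unfolding sets_converge_def
      using eventually_sequentially_seg[of "\<lambda>k. B (diagseq k) i \<inter> _ \<noteq> {}" "Suc n"] by blast
    then show ?thesis ..
  next
    case False
    \<comment> \<open>In an unrestricted coordinate every set is the whole space, so any point is a
      limit.\<close>
    then have eq: "B n i = topspace (X i)" for n using i by (auto simp: J_def)
    then obtain x where x: "x \<in> topspace (X i)" using B(2)[OF i] by blast
    have "sets_converge (X i) (\<lambda>k. B (diagseq k) i) x"
      using x by (auto simp: sets_converge_def eq intro!: always_eventually)
    then show ?thesis ..
  qed
  then obtain x where x: "\<And>i. i \<in> I \<Longrightarrow> sets_converge (X i) (\<lambda>k. B (diagseq k) i) (x i)"
    by metis
  have "\<forall>\<^sub>F k in sequentially. U (diagseq k) \<inter> P \<noteq> {}"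
    if P: "openin (product_topology X I) P" "restrict x I \<in> P" for P
  proof -
    obtain V where V: "finite {i \<in> I. V i \<noteq> topspace (X i)}" "\<forall>i\<in>I. openin (X i) (V i)"
      "restrict x I \<in> Pi\<^sub>E I V" "Pi\<^sub>E I V \<subseteq> P"
      using P unfolding openin_product_topology_alt by metis
    have "\<forall>\<^sub>F k in sequentially. B (diagseq k) i \<inter> V i \<noteq> {}" if "i \<in> I" for i
      using x[OF that] V that unfolding sets_converge_def by (auto simp: PiE_iff)
    \<comment> \<open>Only finitely many coordinates of the box \<open>V\<close> impose a condition,
      so one tail serves them all. In the others \<open>V i\<close> is the whole space and the
      nonempty \<open>B (diagseq k) i\<close> meets it.\<close>
    then have "\<forall>\<^sub>F k in sequentially. \<forall>i\<in>{i \<in> I. V i \<noteq> topspace (X i)}.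
        B (diagseq k) i \<inter> V i \<noteq> {}"
      using V(1) by (intro eventually_ball_finite) auto
    then show ?thesis
    proof eventually_elim
      case (elim k)
      have "B (diagseq k) i \<inter> V i \<noteq> {}" if i: "i \<in> I" for i
      proof (cases "V i = topspace (X i)")
        case True
        then show ?thesis using B[OF i] openin_subset by (metis inf.absorb_iff1)
      qed (use elim i in auto)
      then have "Pi\<^sub>E I (\<lambda>i. B (diagseq k) i \<inter> V i) \<noteq> {}"
        by (simp add: PiE_eq_empty_iff)
      moreover have "Pi\<^sub>E I (\<lambda>i. B (diagseq k) i \<inter> V i) \<subseteq> U (diagseq k) \<inter> P"
        using BU[of "diagseq k"] V(4) unfolding PiE_Int[symmetric] by blast
      ultimately show ?case by blast
    qed
  qed
  moreover have "restrict x I \<in> topspace (product_topology X I)"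
    using x by (auto simp: sets_converge_def)
  ultimately have "sets_converge (product_topology X I) (U \<circ> diagseq) (restrict x I)"
    by (simp add: sets_converge_def)
  then show "\<exists>(r :: nat \<Rightarrow> nat) x. strict_mono r \<and> sets_converge (product_topology X I) (U \<circ> r) x"
    using subseq_diagseq by (intro exI conjI)
qed

lemma tychonoff_space_product:
  assumes "\<And>i. i \<in> I \<Longrightarrow> tychonoff_space (X i)"
  shows "tychonoff_space (product_topology X I)"
  using assms
  by (auto simp: tychonoff_space_def completely_regular_space_product_topology
      Hausdorff_space_product_topology)

section \<open>MV-algebras\<close>

context mv_algebra
begin

lemma plus_closed: "x \<in> carrier A \<Longrightarrow> y \<in> carrier A \<Longrightarrow> x \<oplus> y \<in> carrier A"
  and zero_closed: "\<zero> \<in> carrier A"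
  and plus_assoc: "x \<in> carrier A \<Longrightarrow> y \<in> carrier A \<Longrightarrow> z \<in> carrier A \<Longrightarrow>
    (x \<oplus> y) \<oplus> z = x \<oplus> (y \<oplus> z)"
  and plus_comm: "x \<in> carrier A \<Longrightarrow> y \<in> carrier A \<Longrightarrow> x \<oplus> y = y \<oplus> x"
  and zero_plus: "x \<in> carrier A \<Longrightarrow> \<zero> \<oplus> x = x"
proof -
  interpret M: comm_monoid "\<lparr>carrier = carrier A, mult = mv_plus A, one = mv_zero A\<rparr>"
    by (rule comm_monoid)
  show "x \<in> carrier A \<Longrightarrow> y \<in> carrier A \<Longrightarrow> x \<oplus> y \<in> carrier A"
    using M.m_closed by simp
  show "\<zero> \<in> carrier A"
    using M.one_closed by simp
  show "x \<in> carrier A \<Longrightarrow> y \<in> carrier A \<Longrightarrow> z \<in> carrier A \<Longrightarrow> (x \<oplus> y) \<oplus> z = x \<oplus> (y \<oplus> z)"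
    using M.m_assoc by simp
  show "x \<in> carrier A \<Longrightarrow> y \<in> carrier A \<Longrightarrow> x \<oplus> y = y \<oplus> x"
    using M.m_comm by simp
  show "x \<in> carrier A \<Longrightarrow> \<zero> \<oplus> x = x"
    using M.l_one by simp
qed

text \<open>Truncated subtraction; in the standard algebra on [0,1] it is max(0, x - y).\<close>

definition diff :: "'a \<Rightarrow> 'a \<Rightarrow> 'a" where
  "diff x y = \<sim> (\<sim> x \<oplus> y)"

text \<open>The infimum of the natural lattice order; on [0,1] it is min(x, y).\<close>

definition meet :: "'a \<Rightarrow> 'a \<Rightarrow> 'a" where
  "meet x y = diff x (diff x y)"

definition malcev :: "'a \<Rightarrow> 'a \<Rightarrow> 'a \<Rightarrow> 'a" where
  "malcev x y z = meet (diff x y \<oplus> z) (diff z y \<oplus> x)"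

lemmas closed = plus_closed zero_closed neg_closed

lemma diff_closed: "x \<in> carrier A \<Longrightarrow> y \<in> carrier A \<Longrightarrow> diff x y \<in> carrier A"
  by (simp add: diff_def closed)

text \<open>The Lukasiewicz axiom at \<open>x\<close> and \<open>\<sim> \<zero>\<close>: one side
  collapses to \<open>\<sim> \<zero>\<close>, the other to
  \<open>\<sim> x \<oplus> x\<close>.\<close>

lemma neg_plus_self:
  assumes x: "x \<in> carrier A"
  shows "\<sim> x \<oplus> x = \<sim> \<zero>"
proof -
  have "\<sim> (\<sim> x \<oplus> \<sim> \<zero>) \<oplus> \<sim> \<zero> = \<sim> (\<sim> (\<sim> \<zero>) \<oplus> x) \<oplus> x"
    using lukasiewicz[of x "\<sim> \<zero>"] x by (simp add: closed)
  then show ?thesis using x by (simp add: closed plus_neg_zero neg_neg zero_plus)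
qed

lemma diff_self_plus: "x \<in> carrier A \<Longrightarrow> y \<in> carrier A \<Longrightarrow> diff y y \<oplus> x = x"
  by (simp add: diff_def neg_plus_self neg_neg closed zero_plus)

text \<open>\<open>diff x y \<oplus> y\<close> is the lattice join, and the Lukasiewicz axiom is
  exactly its symmetry.\<close>

lemma diff_plus_comm:
  "x \<in> carrier A \<Longrightarrow> y \<in> carrier A \<Longrightarrow> diff x y \<oplus> y = diff y x \<oplus> x"
  unfolding diff_def by (rule lukasiewicz)

text \<open>De Morgan duality: the meet is the negation of the join of \<open>\<sim> x\<close> and
  \<open>\<sim> y\<close>, because \<open>diff (\<sim> y) (\<sim> x) = diff x y\<close>.\<close>

lemma meet_comm:
  assumes "x \<in> carrier A" "y \<in> carrier A"
  shows "meet x y = meet y x"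
proof -
  have "\<sim> x \<oplus> diff x y = diff (\<sim> y) (\<sim> x) \<oplus> \<sim> x" if "x \<in> carrier A" "y \<in> carrier A" for x y
    using that by (simp add: diff_def neg_neg closed plus_comm)
  then show ?thesis
    using diff_plus_comm[of "\<sim> x" "\<sim> y"] assms by (simp add: meet_def diff_def[of _ "diff _ _"] closed)
qed

text \<open>Writing the join as \<open>diff y x \<oplus> x\<close> lets \<open>\<sim> x\<close>
  cancel against \<open>x\<close>, so \<open>x\<close> minus the join is zero; subtracting zero from
  \<open>x\<close> leaves \<open>x\<close>.\<close>

lemma meet_join_absorb:
  assumes x: "x \<in> carrier A" and y: "y \<in> carrier A"
  shows "meet x (diff x y \<oplus> y) = x"
proof -
  have "\<sim> x \<oplus> (diff y x \<oplus> x) = diff y x \<oplus> (\<sim> x \<oplus> x)"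
    using x y plus_assoc plus_comm by (metis closed(3) diff_closed)
  also have "\<dots> = \<sim> \<zero>" using x y by (simp add: neg_plus_self plus_neg_zero diff_closed)
  finally have "diff x (diff x y \<oplus> y) = \<zero>"
    using x y by (simp add: diff_plus_comm[of x y]) (simp add: diff_def[of x] neg_neg closed)
  then show ?thesis using x by (simp add: meet_def) (simp add: diff_def plus_comm zero_plus neg_neg closed)
qed

text \<open>Since \<open>diff y y\<close> is zero, one argument of the meet becomes \<open>x\<close>
  and the other the join of \<open>x\<close> and \<open>y\<close>; absorption finishes both
  cases.\<close>

lemma malcev_eqs:
  assumes x: "x \<in> carrier A" and y: "y \<in> carrier A"
  shows "malcev x y y = x" "malcev y y x = x"
proof -
  show "malcev y y x = x"
    using x y by (simp add: malcev_def diff_self_plus meet_join_absorb)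
  have "malcev x y y = meet x (diff x y \<oplus> y)"
    using x y by (simp add: malcev_def diff_self_plus meet_comm closed diff_closed)
  then show "malcev x y y = x" using x y by (simp add: meet_join_absorb)
qed

end

section \<open>Continuity of the Mal'cev term\<close>

context topological_mv_algebra
begin

lemma continuous_map_mv_plus:
  assumes "continuous_map Z T f" "continuous_map Z T g"
  shows "continuous_map Z T (\<lambda>t. f t \<oplus> g t)"
  using continuous_map_compose[OF continuous_map_pairedI[OF assms] continuous_plus]
  by (simp add: o_def)

lemma continuous_map_mv_neg:
  "continuous_map Z T f \<Longrightarrow> continuous_map Z T (\<lambda>t. \<sim> f t)"
  using continuous_map_compose[OF _ continuous_neg] by (simp add: o_def)

lemma malcev_operation_malcev: "malcev_operation T malcev"
proof -
  let ?Z = "prod_topology T (prod_topology T T)"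
  have "continuous_map ?Z T (\<lambda>t. fst (snd t))" "continuous_map ?Z T (\<lambda>t. snd (snd t))"
    using continuous_map_compose[OF continuous_map_snd continuous_map_fst]
      continuous_map_compose[OF continuous_map_snd continuous_map_snd]
    by (simp_all add: o_def)
  then have "continuous_map ?Z T (\<lambda>t. malcev (fst t) (fst (snd t)) (snd (snd t)))"
    unfolding malcev_def meet_def diff_def
    by (intro continuous_map_mv_plus continuous_map_mv_neg continuous_map_fst)
  then show ?thesis
    unfolding malcev_operation_def by (simp add: malcev_eqs topspace_eq case_prod_unfold)
qed

end

section \<open>Products of topological MV-algebras\<close>

lemma mv_algebra_product:
  assumes "\<And>i. i \<in> I \<Longrightarrow> mv_algebra (A i)"
  shows "mv_algebra (product_mv_algebra I A)"
proof (rule mv_algebra.intro)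
  let ?P = "product_mv_algebra I A"
  have carrier: "x i \<in> carrier (A i)" if "x \<in> carrier ?P" "i \<in> I" for x i
    using that by (auto simp: product_mv_algebra_def)
  have ext: "x = y" if "x \<in> carrier ?P" "y \<in> carrier ?P" "\<And>i. i \<in> I \<Longrightarrow> x i = y i" for x y
    using that by (auto simp: product_mv_algebra_def intro: PiE_ext)
  have plus: "(x \<oplus>\<^bsub>?P\<^esub> y) i = x i \<oplus>\<^bsub>A i\<^esub> y i" and neg: "(\<sim>\<^bsub>?P\<^esub> x) i = \<sim>\<^bsub>A i\<^esub> x i"
    and zero: "\<zero>\<^bsub>?P\<^esub> i = \<zero>\<^bsub>A i\<^esub>" if "i \<in> I" for x y i
    using that by (auto simp: product_mv_algebra_def)
  have plus_in: "x \<oplus>\<^bsub>?P\<^esub> y \<in> carrier ?P" if "x \<in> carrier ?P" "y \<in> carrier ?P" for x y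
    using carrier[OF that(1)] carrier[OF that(2)] mv_algebra.plus_closed[OF assms]
    by (auto simp: product_mv_algebra_def)
  have neg_in: "\<sim>\<^bsub>?P\<^esub> x \<in> carrier ?P" if "x \<in> carrier ?P" for x
    using carrier[OF that] mv_algebra.neg_closed[OF assms]
    by (auto simp: product_mv_algebra_def)
  have zero_in: "\<zero>\<^bsub>?P\<^esub> \<in> carrier ?P"
    using mv_algebra.zero_closed[OF assms] by (auto simp: product_mv_algebra_def)
  note closed = plus_in neg_in zero_in
  have assoc: "x \<oplus>\<^bsub>?P\<^esub> y \<oplus>\<^bsub>?P\<^esub> z = x \<oplus>\<^bsub>?P\<^esub> (y \<oplus>\<^bsub>?P\<^esub> z)"
    if "x \<in> carrier ?P" "y \<in> carrier ?P" "z \<in> carrier ?P" for x y z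
    by (rule ext) (simp_all add: that closed plus carrier mv_algebra.plus_assoc[OF assms])
  have comm: "x \<oplus>\<^bsub>?P\<^esub> y = y \<oplus>\<^bsub>?P\<^esub> x" if "x \<in> carrier ?P" "y \<in> carrier ?P" for x y
    by (rule ext) (simp_all add: that closed plus carrier mv_algebra.plus_comm[OF assms])
  have zero_plus: "\<zero>\<^bsub>?P\<^esub> \<oplus>\<^bsub>?P\<^esub> x = x" if "x \<in> carrier ?P" for x
    by (rule ext) (simp_all add: that closed plus zero carrier mv_algebra.zero_plus[OF assms])
  show "comm_monoid \<lparr>carrier = carrier ?P, mult = mv_plus ?P, one = mv_zero ?P\<rparr>"
    by (rule comm_monoidI) (simp_all add: closed assoc zero_plus, rule comm)
  fix x y
  assume x: "x \<in> carrier ?P"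
  then show "\<sim>\<^bsub>?P\<^esub> x \<in> carrier ?P" by (rule neg_in)
  show "\<sim>\<^bsub>?P\<^esub> (\<sim>\<^bsub>?P\<^esub> x) = x"
    by (rule ext) (simp_all add: x closed neg carrier mv_algebra.neg_neg[OF assms])
  show "x \<oplus>\<^bsub>?P\<^esub> \<sim>\<^bsub>?P\<^esub> \<zero>\<^bsub>?P\<^esub> = \<sim>\<^bsub>?P\<^esub> \<zero>\<^bsub>?P\<^esub>"
    by (rule ext) (simp_all add: x closed plus neg zero carrier mv_algebra.plus_neg_zero[OF assms])
  assume y: "y \<in> carrier ?P"
  show "\<sim>\<^bsub>?P\<^esub> (\<sim>\<^bsub>?P\<^esub> x \<oplus>\<^bsub>?P\<^esub> y) \<oplus>\<^bsub>?P\<^esub> y = \<sim>\<^bsub>?P\<^esub> (\<sim>\<^bsub>?P\<^esub> y \<oplus>\<^bsub>?P\<^esub> x) \<oplus>\<^bsub>?P\<^esub> x"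
  proof (rule ext)
    fix i
    assume "i \<in> I"
    then show "(\<sim>\<^bsub>?P\<^esub> (\<sim>\<^bsub>?P\<^esub> x \<oplus>\<^bsub>?P\<^esub> y) \<oplus>\<^bsub>?P\<^esub> y) i = (\<sim>\<^bsub>?P\<^esub> (\<sim>\<^bsub>?P\<^esub> y \<oplus>\<^bsub>?P\<^esub> x) \<oplus>\<^bsub>?P\<^esub> x) i"
      using mv_algebra.lukasiewicz[OF assms, of i "x i" "y i"] by (simp add: x y plus neg carrier)
  qed (simp_all add: x y closed)
qed

lemma topological_mv_algebra_product:
  assumes A: "\<And>i. i \<in> I \<Longrightarrow> topological_mv_algebra (A i) (T i)"
  shows "topological_mv_algebra (product_mv_algebra I A) (product_topology T I)"
proof -
  let ?T = "product_topology T I"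
  interpret mv_algebra "product_mv_algebra I A"
    using A by (intro mv_algebra_product) (simp add: topological_mv_algebra_def)
  show ?thesis
  proof
    show "topspace ?T = carrier (product_mv_algebra I A)"
      using topological_mv_algebra.topspace_eq[OF A]
      by (auto simp: product_mv_algebra_def PiE_iff)
    have "continuous_map (prod_topology ?T ?T) (T i) (\<lambda>p. fst p i \<oplus>\<^bsub>A i\<^esub> snd p i)"
      if "i \<in> I" for i
      using that continuous_map_compose[OF continuous_map_fst continuous_map_product_projection]
        continuous_map_compose[OF continuous_map_snd continuous_map_product_projection]
      by (intro topological_mv_algebra.continuous_map_mv_plus[OF A]) (auto simp: o_def)
    then show "continuous_map (prod_topology ?T ?T) ?T (\<lambda>(x, y). x \<oplus>\<^bsub>product_mv_algebra I A\<^esub> y)"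
      by (auto simp: product_mv_algebra_def continuous_map_componentwise case_prod_unfold)
    have "continuous_map ?T (T i) (\<lambda>x. \<sim>\<^bsub>A i\<^esub> x i)" if "i \<in> I" for i
      using that
      by (intro topological_mv_algebra.continuous_map_mv_neg[OF A]
          continuous_map_product_projection)
    then show "continuous_map ?T ?T (\<lambda>x. \<sim>\<^bsub>product_mv_algebra I A\<^esub> x)"
      by (auto simp: product_mv_algebra_def continuous_map_componentwise)
  qed
qed

section \<open>Pseudocompactness of the product\<close>

theorem theorem3p3:
  fixes \<Lambda> :: "'i set"
    and A :: "'i \<Rightarrow> 'a mv_algebra"
    and T :: "'i \<Rightarrow> 'a topology"
  assumes "\<And>l. l \<in> \<Lambda> \<Longrightarrow> topological_mv_algebra (A l) (T l)"
    and "\<And>l. l \<in> \<Lambda> \<Longrightarrow> tychonoff_space (T l)"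
    and "\<And>l. l \<in> \<Lambda> \<Longrightarrow> pseudocompact_space (T l)"
  shows "topological_mv_algebra (product_mv_algebra \<Lambda> A) (product_topology T \<Lambda>)
    \<and> pseudocompact_space (product_topology T \<Lambda>)"
proof
  show "topological_mv_algebra (product_mv_algebra \<Lambda> A) (product_topology T \<Lambda>)"
    using assms(1) by (rule topological_mv_algebra_product)
  \<comment> \<open>The MV-structure enters the compactness argument only here, through the Mal'cev
    term of each factor.\<close>
  have "sequentially_feebly_compact_space (T l)" if l: "l \<in> \<Lambda>" for l
  proof (rule malcev_imp_sequentially_feebly_compact)
    show "feebly_compact_space (T l)"
      using assms(3)[OF l] by (rule pseudocompact_imp_feebly_compact)
    show "regular_space (T l)"
      using assms(2)[OF l] by (simp add: tychonoff_space_def completely_regular_imp_regular_space)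
    show "malcev_operation (T l) (mv_algebra.malcev (A l))"
      using assms(1)[OF l] by (rule topological_mv_algebra.malcev_operation_malcev)
  qed
  then have "feebly_compact_space (product_topology T \<Lambda>)"
    by (intro sequentially_feebly_compact_imp_feebly_compact sequentially_feebly_compact_product)
  then show "pseudocompact_space (product_topology T \<Lambda>)"
    using feebly_compact_imp_bounded tychonoff_space_product[of \<Lambda> T] assms(2)
    unfolding pseudocompact_space_def by blast
qed

end
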